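(* Let $\mathbf{k}$ be an algebraically closed field and let $\mathfrak{X}_3=\mathfrak{X}(F_3,\mathrm{SL}_2)$ be the $\mathrm{SL}_2$-character variety of the free group $F_3$ over $\mathbf{k}$, with coordinates $$(x,y,z,u,v,w,P)=\big(\operatorname{tr}A,\ \operatorname{tr}B,\ \operatorname{tr}C,\ \operatorname{tr}(BC),\ \operatorname{tr}(AC),\ \operatorname{tr}(AB),\ \operatorname{tr}(ABC)\big)$$ for $(A,B,C)\in\mathfrak{X}_3$, which embed $\mathfrak{X}_3$ in $\mathbf{k}^7$. Then $\mathfrak{X}_3\subset\mathbf{k}^7$ is the hypersurface defined by the equation $$P^2=(wz+vy+ux-xyz)\,P-x^2-y^2-z^2+uyz+vxz+wxy-uvw-u^2-v^2-w^2+4.$$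
   Context: $F_3=\langle x_1,x_2,x_3\rangle$ is the free group on three generators. A representation $\rho:F_3\to\mathrm{SL}_2=\mathrm{SL}_2(\mathbf{k})$ is identified with the triple $(A,B,C)=(\rho(x_1),\rho(x_2),\rho(x_3))\in(\mathrm{SL}_2)^3$, and its character is $\chi_\rho(g)=\operatorname{tr}\rho(g)$. The character variety $\mathfrak{X}(F_3,\mathrm{SL}_2)$ is the set of all characters $\chi_\rho$, with the structure of an affine variety whose coordinate ring is the subalgebra of the ring of regular functions on $(\mathrm{SL}_2)^3$ generated by all trace functions $\rho\mapsto\operatorname{tr}\rho(g)$, $g\in F_3$. It is identified with the GIT quotient $(\mathrm{SL}_2)^3/\!/\mathrm{SL}_2$ by simultaneous conjugation. Its coordinate ring is generated by the seven traces listed in the claim. *)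

theory Defs
  imports "HOL-Analysis.Analysis" "HOL-Algebra.Group"
begin

section \<open>Free groups\<close>

text \<open>A word is a list of letters \<open>(i, b)\<close>, where \<open>b\<close> says whether the letter is the generator
  \<open>i\<close> or its formal inverse.\<close>

inductive free_eq :: "('i \<times> bool) list \<Rightarrow> ('i \<times> bool) list \<Rightarrow> bool" where
  refl: "free_eq s s"
| sym: "free_eq s t \<Longrightarrow> free_eq t s"
| trans: "free_eq s t \<Longrightarrow> free_eq t r \<Longrightarrow> free_eq s r"
| cancel: "free_eq (s @ [(i, b), (i, \<not> b)] @ t) (s @ t)"

lemma free_eq_context: "free_eq s t \<Longrightarrow> free_eq (p @ s @ q) (p @ t @ q)"
proof (induction rule: free_eq.induct)
  case (cancel s i b t)
  then show ?case
    using free_eq.cancel[of "p @ s" i b "t @ q"] by simp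
qed (auto intro: free_eq.intros)

quotient_type 'i fgroup = "('i \<times> bool) list" / free_eq
  by (rule equivpI) (auto simp: reflp_def symp_def transp_def intro: free_eq.intros)

lift_definition fg_one :: "'i fgroup" is "[]" .

lift_definition fg_mult :: "'i fgroup \<Rightarrow> 'i fgroup \<Rightarrow> 'i fgroup" is "(@)"
  using free_eq_context[of _ _ "[]"] free_eq_context[of _ _ _ "[]"]
  by (metis append_Nil append_Nil2 free_eq.trans)

lift_definition fgen :: "'i \<Rightarrow> 'i fgroup" is "\<lambda>i. [(i, True)]" .

definition free_group :: "'i fgroup monoid" where
  "free_group = \<lparr>carrier = UNIV, monoid.mult = fg_mult, one = fg_one\<rparr>"

text \<open>The type \<^typ>\<open>3\<close> of integers modulo 3 only serves as a three-element index set, with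
  elements \<open>1\<close>, \<open>2\<close>, \<open>3\<close>.\<close>

abbreviation F3 :: "3 fgroup monoid" where
  "F3 \<equiv> free_group"


section \<open>Representations and characters\<close>

definition SL2 :: "('k::field ^ 2 ^ 2) monoid" where
  "SL2 = \<lparr>carrier = {M. det M = 1}, monoid.mult = (**), one = mat 1\<rparr>"

type_synonym 'k rep3 = "3 fgroup \<Rightarrow> 'k ^ 2 ^ 2"

abbreviation Rep3 :: "'k::field rep3 set" where
  "Rep3 \<equiv> hom F3 SL2"

definition triple :: "'k::field rep3 \<Rightarrow> ('k ^ 2 ^ 2) \<times> ('k ^ 2 ^ 2) \<times> ('k ^ 2 ^ 2)" where
  "triple \<rho> = (\<rho> (fgen 1), \<rho> (fgen 2), \<rho> (fgen 3))"

definition character :: "'k::field rep3 \<Rightarrow> 3 fgroup \<Rightarrow> 'k" where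
  "character \<rho> g = trace (\<rho> g)"

definition X3 :: "(3 fgroup \<Rightarrow> 'k::field) set" where
  "X3 = character ` Rep3"


section \<open>Coordinate rings\<close>

text \<open>The \<open>'k\<close>-algebra of functions on \<open>D\<close> generated by \<open>S\<close>, with pointwise operations.
  Functions on \<open>D\<close> are normalised to be \<^const>\<open>undefined\<close> outside \<open>D\<close>.\<close>

inductive_set generated_subalgebra :: "'a set \<Rightarrow> ('a \<Rightarrow> 'k::field) set \<Rightarrow> ('a \<Rightarrow> 'k) set"
  for D :: "'a set" and S :: "('a \<Rightarrow> 'k) set" where
  const: "(\<lambda>a\<in>D. c) \<in> generated_subalgebra D S"
| gen: "f \<in> S \<Longrightarrow> (\<lambda>a\<in>D. f a) \<in> generated_subalgebra D S"
| add: "f \<in> generated_subalgebra D S \<Longrightarrow> g \<in> generated_subalgebra D S \<Longrightarrow>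
    (\<lambda>a\<in>D. f a + g a) \<in> generated_subalgebra D S"
| mult: "f \<in> generated_subalgebra D S \<Longrightarrow> g \<in> generated_subalgebra D S \<Longrightarrow>
    (\<lambda>a\<in>D. f a * g a) \<in> generated_subalgebra D S"

text \<open>The coordinate ring of the character variety, as a ring of functions on the representation
  variety; the latter is identified with the set of triples in \<open>SL2\<close> (lemma \<open>bij_betw_triple\<close>).\<close>

definition coordinate_ring_X3 :: "('k::field rep3 \<Rightarrow> 'k) set" where
  "coordinate_ring_X3 = generated_subalgebra Rep3 (range (\<lambda>g \<rho>. trace (\<rho> g)))"

text \<open>The coordinate ring of affine space. Over an infinite field, polynomial functions are the
  same as polynomials.\<close>

definition poly_functions :: "('k::field ^ 'n \<Rightarrow> 'k) set" where
  "poly_functions = generated_subalgebra UNIV (range (\<lambda>i p. p $ i))"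

definition vanishing_ideal :: "('k::field ^ 'n) set \<Rightarrow> ('k ^ 'n \<Rightarrow> 'k) set" where
  "vanishing_ideal V = {f \<in> poly_functions. \<forall>p\<in>V. f p = 0}"

definition principal_ideal :: "('k::field ^ 'n \<Rightarrow> 'k) \<Rightarrow> ('k ^ 'n \<Rightarrow> 'k) set" where
  "principal_ideal f = {\<lambda>p. f p * q p | q. q \<in> poly_functions}"


section \<open>The seven trace coordinates\<close>

definition trace_coords :: "(3 fgroup \<Rightarrow> 'k::field) \<Rightarrow> 'k ^ 7" where
  "trace_coords \<phi> =
    (let a = fgen 1; b = fgen 2; c = fgen 3 in
      vector [\<phi> a, \<phi> b, \<phi> c,
        \<phi> (b \<otimes>\<^bsub>F3\<^esub> c), \<phi> (a \<otimes>\<^bsub>F3\<^esub> c), \<phi> (a \<otimes>\<^bsub>F3\<^esub> b), \<phi> (a \<otimes>\<^bsub>F3\<^esub> b \<otimes>\<^bsub>F3\<^esub> c)])"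

definition fricke :: "'k::field ^ 7 \<Rightarrow> 'k" where
  "fricke p =
    (let x = p $ 1; y = p $ 2; z = p $ 3; u = p $ 4; v = p $ 5; w = p $ 6; P = p $ 7 in
      P\<^sup>2 - ((w * z + v * y + u * x - x * y * z) * P - x\<^sup>2 - y\<^sup>2 - z\<^sup>2
        + u * y * z + v * x * z + w * x * y - u * v * w - u\<^sup>2 - v\<^sup>2 - w\<^sup>2 + 4))"


section \<open>Agreement with the usual descriptions\<close>

lemma vector_7:
  "(vector [x1, x2, x3, x4, x5, x6, x7] :: 'k::zero ^ 7) $ 1 = x1"
  "(vector [x1, x2, x3, x4, x5, x6, x7] :: 'k ^ 7) $ 2 = x2"
  "(vector [x1, x2, x3, x4, x5, x6, x7] :: 'k ^ 7) $ 3 = x3"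
  "(vector [x1, x2, x3, x4, x5, x6, x7] :: 'k ^ 7) $ 4 = x4"
  "(vector [x1, x2, x3, x4, x5, x6, x7] :: 'k ^ 7) $ 5 = x5"
  "(vector [x1, x2, x3, x4, x5, x6, x7] :: 'k ^ 7) $ 6 = x6"
  "(vector [x1, x2, x3, x4, x5, x6, x7] :: 'k ^ 7) $ 7 = x7"
  unfolding vector_def by simp_all

lemma free_group_simps [simp]:
  "carrier free_group = UNIV" "x \<otimes>\<^bsub>free_group\<^esub> y = fg_mult x y" "\<one>\<^bsub>free_group\<^esub> = fg_one"
  by (simp_all add: free_group_def)

lemma SL2_simps [simp]:
  "carrier SL2 = {M. det M = 1}" "A \<otimes>\<^bsub>SL2\<^esub> B = A ** B" "\<one>\<^bsub>SL2\<^esub> = mat 1"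
  by (simp_all add: SL2_def)

lemma free_eq_inverse: "free_eq (map (\<lambda>(i, b). (i, \<not> b)) (rev s) @ s) []"
proof (induction s)
  case (Cons l s)
  obtain i b where l: "l = (i, b)" by (cases l)
  have "free_eq (map (\<lambda>(i, b). (i, \<not> b)) (rev s) @ [(i, \<not> b), (i, \<not> \<not> b)] @ s)
      (map (\<lambda>(i, b). (i, \<not> b)) (rev s) @ s)"
    by (rule free_eq.cancel)
  then show ?case
    using Cons.IH free_eq.trans by (fastforce simp: l)
qed (simp add: free_eq.refl)

lemma group_free_group: "group (free_group :: 'i fgroup monoid)"
proof (rule groupI)
  fix x y z :: "'i fgroup"
  show "x \<otimes>\<^bsub>free_group\<^esub> y \<otimes>\<^bsub>free_group\<^esub> z = x \<otimes>\<^bsub>free_group\<^esub> (y \<otimes>\<^bsub>free_group\<^esub> z)"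
    unfolding free_group_simps by transfer (simp add: free_eq.refl)
  show "\<one>\<^bsub>free_group\<^esub> \<otimes>\<^bsub>free_group\<^esub> x = x"
    unfolding free_group_simps by transfer (simp add: free_eq.refl)
  show "\<exists>y\<in>carrier free_group. y \<otimes>\<^bsub>free_group\<^esub> x = \<one>\<^bsub>free_group\<^esub>"
    unfolding free_group_simps bex_UNIV by transfer (use free_eq_inverse in blast)
qed simp_all

lemma group_SL2: "group (SL2 :: ('k::field ^ 2 ^ 2) monoid)"
proof (rule groupI)
  fix A :: "'k ^ 2 ^ 2"
  assume "A \<in> carrier SL2"
  then have d: "det A = 1" by simp
  then obtain B where B: "B ** A = mat 1"
    using invertible_det_nz[of A] unfolding invertible_def by auto
  have "det B * det A = 1"
    using B by (metis det_I det_mul)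
  then show "\<exists>B\<in>carrier SL2. B \<otimes>\<^bsub>SL2\<^esub> A = \<one>\<^bsub>SL2\<^esub>"
    using B d by auto
qed (auto simp: det_mul matrix_mul_assoc)

text \<open>The universal property: a representation of \<open>F3\<close> is the same thing as a triple.\<close>

fun letter_val :: "('i \<Rightarrow> 'a) \<Rightarrow> ('a, 'm) monoid_scheme \<Rightarrow> 'i \<times> bool \<Rightarrow> 'a" where
  "letter_val f G (i, b) = (if b then f i else inv\<^bsub>G\<^esub> f i)"

definition word_val :: "('i \<Rightarrow> 'a) \<Rightarrow> ('a, 'm) monoid_scheme \<Rightarrow> ('i \<times> bool) list \<Rightarrow> 'a" where
  "word_val f G s = foldr (\<lambda>l a. letter_val f G l \<otimes>\<^bsub>G\<^esub> a) s \<one>\<^bsub>G\<^esub>"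

context group
begin

lemma letter_val_closed: "(\<And>i. f i \<in> carrier G) \<Longrightarrow> letter_val f G l \<in> carrier G"
  by (cases l) simp

lemma word_val_closed: "(\<And>i. f i \<in> carrier G) \<Longrightarrow> word_val f G s \<in> carrier G"
  by (induction s) (simp_all add: word_val_def letter_val_closed)

lemma word_val_append:
  "(\<And>i. f i \<in> carrier G) \<Longrightarrow> word_val f G (s @ t) = word_val f G s \<otimes> word_val f G t"
proof (induction s)
  case Nil
  then show ?case using word_val_closed[of f t] by (simp add: word_val_def)
next
  case (Cons l s)
  then show ?case
    using word_val_closed[of f s] word_val_closed[of f t] letter_val_closed[of f l]
    by (simp add: word_val_def m_assoc)
qed

lemma word_val_free_eq:
  assumes "\<And>i. f i \<in> carrier G"
  shows "free_eq s t \<Longrightarrow> word_val f G s = word_val f G t"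
proof (induction rule: free_eq.induct)
  case (cancel s i b t)
  have "word_val f G [(i, b), (i, \<not> b)] = \<one>"
    using assms[of i] by (simp add: word_val_def)
  then show ?case
    using assms word_val_closed[of f t] by (simp only: word_val_append l_one)
qed simp_all

lemma free_group_hom_exists:
  assumes f: "\<And>i. f i \<in> carrier G"
  shows "\<exists>h\<in>hom free_group G. \<forall>i. h (fgen i) = f i"
proof -
  define h where "h = (\<lambda>x. word_val f G (rep_fgroup x))"
  have h: "h (abs_fgroup s) = word_val f G s" for s
    unfolding h_def
    by (metis Quotient_fgroup Quotient_rep_abs f free_eq.refl word_val_free_eq)
  have "h (fg_mult x y) = h x \<otimes> h y" for x y
  proof -
    obtain s t where "x = abs_fgroup s" "y = abs_fgroup t"
      by (metis Quotient_abs_rep Quotient_fgroup)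
    then show ?thesis
      using f by (simp add: fg_mult.abs_eq h word_val_append)
  qed
  moreover have "h x \<in> carrier G" for x
    unfolding h_def by (rule word_val_closed) (rule f)
  moreover have "h (fgen i) = f i" for i
    using f[of i] by (simp add: fgen.abs_eq h word_val_def)
  ultimately show ?thesis
    by (intro bexI[of _ h] homI) auto
qed

lemma free_group_hom_unique:
  fixes h k :: "'i fgroup \<Rightarrow> 'a"
  assumes h: "h \<in> hom free_group G" and k: "k \<in> hom free_group G"
    and eq: "\<And>i. h (fgen i) = k (fgen i)"
  shows "h = k"
proof
  interpret F: group "free_group :: 'i fgroup monoid" by (rule group_free_group)
  interpret h: group_hom free_group G h by unfold_locales (rule h)
  interpret k: group_hom free_group G k by unfold_locales (rule k)
  have letter: "h (abs_fgroup [(i, b)]) = k (abs_fgroup [(i, b)])" for i b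
  proof (cases b)
    case True
    then show ?thesis using eq[of i] by (simp add: fgen.abs_eq)
  next
    case False
    have "fg_mult (abs_fgroup [(i, False)]) (fgen i) = fg_one"
      using free_eq.cancel[of "[]" i False "[]"]
      by (simp add: fgen.abs_eq fg_mult.abs_eq fg_one.abs_eq fgroup.abs_eq_iff)
    then have "abs_fgroup [(i, b)] = inv\<^bsub>free_group\<^esub> fgen i"
      using False F.inv_equality by fastforce
    then show ?thesis using eq[of i] by (simp add: h.hom_inv k.hom_inv)
  qed
  have word: "h (abs_fgroup s) = k (abs_fgroup s)" for s
  proof (induction s)
    case Nil
    then show ?case using h.hom_one k.hom_one by (simp add: fg_one.abs_eq)
  next
    case (Cons l s)
    have l: "abs_fgroup (l # s) = fg_mult (abs_fgroup [l]) (abs_fgroup s)"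
      by (simp add: fg_mult.abs_eq)
    show ?case
      using Cons letter[of "fst l" "snd l"] h.hom_mult[of "abs_fgroup [l]" "abs_fgroup s"]
        k.hom_mult[of "abs_fgroup [l]" "abs_fgroup s"] by (simp add: l)
  qed
  fix x show "h x = k x"
    using word[of "rep_fgroup x"] by (metis Quotient_abs_rep Quotient_fgroup)
qed

end

lemma bij_betw_triple:
  "bij_betw triple (Rep3 :: 'k::field rep3 set) ({M. det M = 1} \<times> {M. det M = 1} \<times> {M. det M = 1})"
proof (rule bij_betw_imageI)
  interpret S: group "SL2 :: ('k ^ 2 ^ 2) monoid" by (rule group_SL2)
  show "inj_on triple (Rep3 :: 'k rep3 set)"
  proof (rule inj_onI)
    fix \<rho> \<sigma> :: "'k rep3"
    assume "\<rho> \<in> Rep3" "\<sigma> \<in> Rep3" "triple \<rho> = triple \<sigma>"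
    moreover from this have "\<rho> (fgen i) = \<sigma> (fgen i)" for i
      using exhaust_3[of i] by (auto simp: triple_def)
    ultimately show "\<rho> = \<sigma>" using S.free_group_hom_unique by blast
  qed
  show "triple ` (Rep3 :: 'k rep3 set) = {M. det M = 1} \<times> {M. det M = 1} \<times> {M. det M = 1}"
  proof (intro equalityI subsetI)
    fix T assume "T \<in> triple ` (Rep3 :: 'k rep3 set)"
    then show "T \<in> {M. det M = 1} \<times> {M. det M = 1} \<times> {M. det M = 1}"
      by (auto simp: triple_def hom_def)
  next
    fix T :: "('k ^ 2 ^ 2) \<times> ('k ^ 2 ^ 2) \<times> ('k ^ 2 ^ 2)"
    assume "T \<in> {M. det M = 1} \<times> {M. det M = 1} \<times> {M. det M = 1}"
    then obtain A B C where T: "T = (A, B, C)" "det A = 1" "det B = 1" "det C = 1" by auto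
    define f :: "3 \<Rightarrow> 'k ^ 2 ^ 2" where "f i = (if i = 1 then A else if i = 2 then B else C)" for i
    have f_carrier: "f i \<in> carrier SL2" for i
      using T by (simp add: f_def)
    obtain \<rho> where "\<rho> \<in> hom F3 SL2" "\<And>i. \<rho> (fgen i) = f i"
      using S.free_group_hom_exists[of f] f_carrier by blast
    then show "T \<in> triple ` Rep3"
      by (intro image_eqI[of _ _ \<rho>]) (simp_all add: triple_def f_def T)
  qed
qed

lemma trace_coords_character:
  assumes "\<rho> \<in> Rep3" "triple \<rho> = (A, B, C)"
  shows "trace_coords (character \<rho>) =
    vector [trace A, trace B, trace C, trace (B ** C), trace (A ** C), trace (A ** B),
      trace (A ** B ** C)]"
  using assms by (auto simp: trace_coords_def character_def triple_def hom_def Let_def)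

end

theory Submission
  imports Defs
begin

text \<open>
  Over the ring of polynomials in the seven traces, the eight products \<open>1, A, B, C, AB, AC, BC, ABC\<close>
  span a module closed under left multiplication by \<open>A\<close>, \<open>B\<close>, \<open>C\<close>, because of the Cayley-Hamilton
  identity and the formula for \<open>AB + BA\<close>. So every word lies in this module and its trace is a
  polynomial in the seven traces, which gives the coordinate ring and injectivity.

  Conversely, given a point of the hypersurface, one solves a linear system for \<open>C\<close> if one of the
  pairs \<open>(A, B)\<close>, \<open>(C, A)\<close> is irreducible, and uses triangular matrices otherwise. Finally, a
  polynomial vanishing on the hypersurface has a remainder \<open>r P + s\<close> modulo the equation, which is
  monic and quadratic in \<open>P\<close>; two distinct roots in \<open>P\<close> over a generic point force \<open>r = s = 0\<close>. This
  works in every characteristic, since the discriminant is not the zero polynomial even in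
  characteristic 2.
\<close>

section \<open>Matrices of size two\<close>

lemma trace_2: "trace (A :: 'k::semiring_1 ^ 2 ^ 2) = A $ 1 $ 1 + A $ 2 $ 2"
  by (simp add: trace_def sum_2)

lemma mat2_eq_iff:
  "(A :: 'k ^ 2 ^ 2) = B \<longleftrightarrow>
    A $ 1 $ 1 = B $ 1 $ 1 \<and> A $ 1 $ 2 = B $ 1 $ 2 \<and> A $ 2 $ 1 = B $ 2 $ 1 \<and> A $ 2 $ 2 = B $ 2 $ 2"
  by (simp add: vec_eq_iff forall_2)

lemmas mat2_entries = matrix_matrix_mult_def sum_2 mat_def

lemma mat2_cayley_hamilton:
  fixes A :: "'k::field ^ 2 ^ 2"
  assumes "det A = 1"
  shows "A ** A = mat (trace A) ** A + mat (- 1)"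
proof -
  have "A $ 1 $ 1 * A $ 2 $ 2 - A $ 1 $ 2 * A $ 2 $ 1 = 1"
    using assms by (simp add: det_2)
  then show ?thesis
    by (simp add: mat2_eq_iff mat2_entries trace_2) (simp add: algebra_simps)
qed

text \<open>By Cayley-Hamilton, \<open>A\<close> times \<open>tr A - A\<close> is the identity. This
  turns an inverse letter of a word into a combination of the identity and a generator.\<close>

lemma mat2_inverse:
  fixes A B :: "'k::field ^ 2 ^ 2"
  assumes "det A = 1" "B ** A = mat 1"
  shows "B = mat (trace A) + mat (- 1) ** A"
proof -
  have "A ** (mat (trace A) + mat (- 1) ** A) = mat 1"
    using assms(1) by (simp add: mat2_eq_iff mat2_entries trace_2 det_2) (simp add: algebra_simps)
  then have "B = (B ** A) ** (mat (trace A) + mat (- 1) ** A)"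
    by (simp flip: matrix_mul_assoc)
  then show ?thesis by (simp add: assms(2))
qed

text \<open>This is the Cayley-Hamilton identity polarised, from \<open>A\<close> to
  \<open>A + B\<close>. It sorts generators into the order of the eight spanning products.\<close>

lemma mat2_swap:
  fixes A B :: "'k::field ^ 2 ^ 2"
  shows "B ** A = mat (- 1) ** (A ** B) + mat (trace A) ** B + mat (trace B) ** A
    + mat (trace (A ** B) - trace A * trace B)"
  by (simp add: mat2_eq_iff mat2_entries trace_2) (simp add: algebra_simps)

lemma matrix_add_rdistrib: "(A + B) ** C = A ** C + B ** (C :: 'k::semiring_1 ^ 'n ^ 'm)"
  by (vector matrix_matrix_mult_def sum.distrib distrib_right)

lemma mat_scale_nth: "(mat c ** A) $ i $ j = c * A $ i $ j" for c :: "'k::semiring_1"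
  by (simp add: matrix_matrix_mult_def mat_def if_distrib[of "\<lambda>x. x * _"] cong: if_cong)

lemma scale_mat_nth: "(A ** mat c) $ i $ j = A $ i $ j * c" for c :: "'k::semiring_1"
  by (simp add: matrix_matrix_mult_def mat_def if_distrib[of "\<lambda>x. _ * x"] cong: if_cong)

text \<open>Scaling is written as multiplication by a scalar matrix; these are central, so
  coefficients pass through any product.\<close>

lemma mat_scale_commute: "A ** (mat c ** B) = mat (c :: 'k::comm_semiring_1) ** (A ** B)"
proof -
  have "A ** mat c = mat c ** A"
    by (simp add: vec_eq_iff mat_scale_nth scale_mat_nth mult.commute)
  then show ?thesis by (simp add: matrix_mul_assoc)
qed

lemma trace_mat_scale: "trace (mat c ** A) = c * trace A" for c :: "'k::semiring_1"
  by (simp add: trace_def mat_scale_nth sum_distrib_left)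

section \<open>Polynomial functions\<close>

lemma exhaust_7:
  fixes i :: 7
  shows "i = 1 \<or> i = 2 \<or> i = 3 \<or> i = 4 \<or> i = 5 \<or> i = 6 \<or> i = 7"
proof (induct i)
  case (of_int z)
  \<comment> \<open>In the type \<open>7\<close> the numeral 7 equals 0, so \<open>z = 0\<close> is
    the case \<open>i = 7\<close>.\<close>
  then have "z = 0 \<or> z = 1 \<or> z = 2 \<or> z = 3 \<or> z = 4 \<or> z = 5 \<or> z = 6" by fastforce
  then show ?case by auto
qed

lemma poly_functions_intros:
  shows poly_functions_const: "(\<lambda>p. c) \<in> (poly_functions :: ('k::field ^ 'n \<Rightarrow> 'k) set)"
    and poly_functions_coord: "(\<lambda>p. p $ i) \<in> (poly_functions :: ('k ^ 'n \<Rightarrow> 'k) set)"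
    and poly_functions_add: "\<And>f g :: 'k ^ 'n \<Rightarrow> 'k. f \<in> poly_functions \<Longrightarrow> g \<in> poly_functions
      \<Longrightarrow> (\<lambda>p. f p + g p) \<in> poly_functions"
    and poly_functions_mult: "\<And>f g :: 'k ^ 'n \<Rightarrow> 'k. f \<in> poly_functions \<Longrightarrow> g \<in> poly_functions
      \<Longrightarrow> (\<lambda>p. f p * g p) \<in> poly_functions"
  using generated_subalgebra.const[of c UNIV "range (\<lambda>i (p :: 'k ^ 'n). p $ i)"]
    generated_subalgebra.gen[of "\<lambda>p. p $ i" "range (\<lambda>i (p :: 'k ^ 'n). p $ i)" UNIV]
    generated_subalgebra.add[of _ UNIV] generated_subalgebra.mult[of _ UNIV]
  by (auto simp: poly_functions_def restrict_def)

lemma poly_functions_uminus: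
  "f \<in> poly_functions \<Longrightarrow> (\<lambda>p. - f p) \<in> poly_functions"
  using poly_functions_mult[OF poly_functions_const[of "- 1"], of f] by simp

lemma poly_functions_diff:
  "f \<in> poly_functions \<Longrightarrow> g \<in> poly_functions \<Longrightarrow> (\<lambda>p. f p - g p) \<in> poly_functions"
  using poly_functions_add[OF _ poly_functions_uminus, of f g] by simp

lemma poly_functions_power:
  "f \<in> poly_functions \<Longrightarrow> (\<lambda>p. f p ^ n) \<in> poly_functions"
  by (induction n) (auto intro: poly_functions_intros)

lemma poly_functions_induct [consumes 1, case_names const coord add mult]:
  assumes "f \<in> (poly_functions :: ('k::field ^ 'n \<Rightarrow> 'k) set)"
    and "\<And>c. Q (\<lambda>p. c)" "\<And>i. Q (\<lambda>p. p $ i)"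
    and "\<And>f g. f \<in> poly_functions \<Longrightarrow> Q f \<Longrightarrow> g \<in> poly_functions \<Longrightarrow> Q g \<Longrightarrow> Q (\<lambda>p. f p + g p)"
    and "\<And>f g. f \<in> poly_functions \<Longrightarrow> Q f \<Longrightarrow> g \<in> poly_functions \<Longrightarrow> Q g \<Longrightarrow> Q (\<lambda>p. f p * g p)"
  shows "Q f"
  using assms(1) unfolding poly_functions_def
  by (induction rule: generated_subalgebra.induct) (use assms(2-) in \<open>auto simp: poly_functions_def restrict_def\<close>)

section \<open>Traces of words\<close>

text \<open>Only values on \<open>Rep3\<close> are constrained, since determinants are known to be 1
  only there.\<close>

definition trace_polynomials :: "('k::field rep3 \<Rightarrow> 'k) set" where
  "trace_polynomials =
    {f. \<exists>F\<in>poly_functions. \<forall>\<rho>\<in>Rep3. f \<rho> = F (trace_coords (character \<rho>))}"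

lemma trace_polynomials_cong:
  "f \<in> trace_polynomials \<Longrightarrow> (\<And>\<rho>. \<rho> \<in> Rep3 \<Longrightarrow> g \<rho> = f \<rho>) \<Longrightarrow> g \<in> trace_polynomials"
  by (auto simp: trace_polynomials_def)

lemma trace_polynomials_const: "(\<lambda>\<rho>. c) \<in> trace_polynomials"
  by (auto simp: trace_polynomials_def intro!: bexI[of _ "\<lambda>p. c"] poly_functions_intros)

lemma trace_polynomials_add:
  "f \<in> trace_polynomials \<Longrightarrow> g \<in> trace_polynomials \<Longrightarrow> (\<lambda>\<rho>. f \<rho> + g \<rho>) \<in> trace_polynomials"
  unfolding trace_polynomials_def using poly_functions_add by fastforce

lemma trace_polynomials_mult:
  "f \<in> trace_polynomials \<Longrightarrow> g \<in> trace_polynomials \<Longrightarrow> (\<lambda>\<rho>. f \<rho> * g \<rho>) \<in> trace_polynomials"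
  unfolding trace_polynomials_def using poly_functions_mult by fastforce

lemma trace_polynomials_diff:
  "f \<in> trace_polynomials \<Longrightarrow> g \<in> trace_polynomials \<Longrightarrow> (\<lambda>\<rho>. f \<rho> - g \<rho>) \<in> trace_polynomials"
  unfolding trace_polynomials_def using poly_functions_diff by fastforce

lemma trace_coords_rep:
  assumes "\<rho> \<in> (Rep3 :: 'k::field rep3 set)"
  shows "trace_coords (character \<rho>) =
    vector [trace (\<rho> (fgen 1)), trace (\<rho> (fgen 2)), trace (\<rho> (fgen 3)),
      trace (\<rho> (fgen 2) ** \<rho> (fgen 3)), trace (\<rho> (fgen 1) ** \<rho> (fgen 3)),
      trace (\<rho> (fgen 1) ** \<rho> (fgen 2)), trace (\<rho> (fgen 1) ** \<rho> (fgen 2) ** \<rho> (fgen 3))]"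
  using trace_coords_character[OF assms triple_def] .

lemma trace_coordinates_in_trace_polynomials:
  fixes i :: 3
  shows "(\<lambda>\<rho>. trace (\<rho> (fgen i))) \<in> (trace_polynomials :: ('k::field rep3 \<Rightarrow> 'k) set)"
    "(\<lambda>\<rho>. trace (\<rho> (fgen 1) ** \<rho> (fgen 2))) \<in> (trace_polynomials :: ('k rep3 \<Rightarrow> 'k) set)"
    "(\<lambda>\<rho>. trace (\<rho> (fgen 1) ** \<rho> (fgen 3))) \<in> (trace_polynomials :: ('k rep3 \<Rightarrow> 'k) set)"
    "(\<lambda>\<rho>. trace (\<rho> (fgen 2) ** \<rho> (fgen 3))) \<in> (trace_polynomials :: ('k rep3 \<Rightarrow> 'k) set)"
    "(\<lambda>\<rho>. trace (\<rho> (fgen 1) ** (\<rho> (fgen 2) ** \<rho> (fgen 3)))) \<in> (trace_polynomials :: ('k rep3 \<Rightarrow> 'k) set)"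
proof -
  have coord: "f \<in> trace_polynomials"
    if "\<And>\<rho>. \<rho> \<in> Rep3 \<Longrightarrow> f \<rho> = trace_coords (character \<rho>) $ j" for f :: "'k rep3 \<Rightarrow> 'k" and j
    unfolding trace_polynomials_def using that
    by (intro CollectI bexI[OF _ poly_functions_coord[of j]] ballI)
  show "(\<lambda>\<rho>. trace (\<rho> (fgen i))) \<in> (trace_polynomials :: ('k rep3 \<Rightarrow> 'k) set)"
    using exhaust_3[of i]
  proof (elim disjE)
    assume "i = 1"
    then show ?thesis by (intro coord[of _ 1]) (simp add: trace_coords_rep vector_7)
  next
    assume "i = 2"
    then show ?thesis by (intro coord[of _ 2]) (simp add: trace_coords_rep vector_7)
  next
    assume "i = 3"
    then show ?thesis by (intro coord[of _ 3]) (simp only: trace_coords_rep vector_7)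
  qed
  show "(\<lambda>\<rho>. trace (\<rho> (fgen 1) ** \<rho> (fgen 2))) \<in> (trace_polynomials :: ('k rep3 \<Rightarrow> 'k) set)"
    by (rule coord[of _ 6]) (simp add: trace_coords_rep vector_7)
  show "(\<lambda>\<rho>. trace (\<rho> (fgen 1) ** \<rho> (fgen 3))) \<in> (trace_polynomials :: ('k rep3 \<Rightarrow> 'k) set)"
    by (rule coord[of _ 5]) (simp add: trace_coords_rep vector_7)
  show "(\<lambda>\<rho>. trace (\<rho> (fgen 2) ** \<rho> (fgen 3))) \<in> (trace_polynomials :: ('k rep3 \<Rightarrow> 'k) set)"
    by (rule coord[of _ 4]) (simp add: trace_coords_rep vector_7)
  show "(\<lambda>\<rho>. trace (\<rho> (fgen 1) ** (\<rho> (fgen 2) ** \<rho> (fgen 3)))) \<in> (trace_polynomials :: ('k rep3 \<Rightarrow> 'k) set)"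
    by (rule coord[of _ 7]) (simp add: trace_coords_rep vector_7 matrix_mul_assoc)
qed

text \<open>The module over \<open>trace_polynomials\<close> spanned by the eight products, nested
  to the right so that a generator multiplied from the left meets the first factor. Rule
  \<open>cong\<close> identifies families that agree on \<open>Rep3\<close>.\<close>

inductive_set trace_module :: "('k::field rep3 \<Rightarrow> 'k ^ 2 ^ 2) set" where
  one: "(\<lambda>\<rho>. mat 1) \<in> trace_module"
| c: "(\<lambda>\<rho>. \<rho> (fgen 3)) \<in> trace_module"
| b: "(\<lambda>\<rho>. \<rho> (fgen 2)) \<in> trace_module"
| bc: "(\<lambda>\<rho>. \<rho> (fgen 2) ** \<rho> (fgen 3)) \<in> trace_module"
| a: "(\<lambda>\<rho>. \<rho> (fgen 1)) \<in> trace_module"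
| ac: "(\<lambda>\<rho>. \<rho> (fgen 1) ** \<rho> (fgen 3)) \<in> trace_module"
| ab: "(\<lambda>\<rho>. \<rho> (fgen 1) ** \<rho> (fgen 2)) \<in> trace_module"
| abc: "(\<lambda>\<rho>. \<rho> (fgen 1) ** (\<rho> (fgen 2) ** \<rho> (fgen 3))) \<in> trace_module"
| add: "\<Phi> \<in> trace_module \<Longrightarrow> \<Psi> \<in> trace_module \<Longrightarrow> (\<lambda>\<rho>. \<Phi> \<rho> + \<Psi> \<rho>) \<in> trace_module"
| scale: "f \<in> trace_polynomials \<Longrightarrow> \<Phi> \<in> trace_module \<Longrightarrow> (\<lambda>\<rho>. mat (f \<rho>) ** \<Phi> \<rho>) \<in> trace_module"
| cong: "\<Phi> \<in> trace_module \<Longrightarrow> (\<And>\<rho>. \<rho> \<in> Rep3 \<Longrightarrow> \<Psi> \<rho> = \<Phi> \<rho>) \<Longrightarrow> \<Psi> \<in> trace_module"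

text \<open>The trace is linear over the coefficients, and on the eight products it is the constant
  2 or one of the seven coordinates.\<close>

lemma trace_trace_module:
  "\<Phi> \<in> trace_module \<Longrightarrow> (\<lambda>\<rho>. trace (\<Phi> \<rho>)) \<in> trace_polynomials"
proof (induction rule: trace_module.induct)
  case (cong \<Phi> \<Psi>)
  show ?case by (rule trace_polynomials_cong[OF cong.IH]) (simp add: cong.hyps)
qed (simp_all add: trace_coordinates_in_trace_polynomials trace_polynomials_const trace_I
    trace_polynomials_add trace_polynomials_mult trace_add trace_mat_scale)

lemma trace_module_square:
  assumes "\<Phi> \<in> trace_module" "(\<lambda>\<rho>. \<rho> (fgen i) ** \<Phi> \<rho>) \<in> trace_module"
  shows "(\<lambda>\<rho>. \<rho> (fgen i) ** (\<rho> (fgen i) ** \<Phi> \<rho>)) \<in> trace_module"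
proof (rule trace_module.cong)
  show "(\<lambda>\<rho>. mat (trace (\<rho> (fgen i))) ** (\<rho> (fgen i) ** \<Phi> \<rho>) + mat (- 1) ** \<Phi> \<rho>)
      \<in> trace_module"
    by (intro trace_module.add trace_module.scale assms trace_coordinates_in_trace_polynomials
        trace_polynomials_const)
  fix \<rho> :: "'a rep3" assume "\<rho> \<in> Rep3"
  then have "det (\<rho> (fgen i)) = 1" by (auto simp: hom_def)
  then show "\<rho> (fgen i) ** (\<rho> (fgen i) ** \<Phi> \<rho>) =
      mat (trace (\<rho> (fgen i))) ** (\<rho> (fgen i) ** \<Phi> \<rho>) + mat (- 1) ** \<Phi> \<rho>"
    by (simp only: matrix_mul_assoc mat2_cayley_hamilton matrix_add_rdistrib)
qed

text \<open>By \<open>mat2_swap\<close> the product in the wrong order is a combination of the four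
  families in the premises, with coefficients in \<open>trace_polynomials\<close>.\<close>

lemma trace_module_swap:
  fixes \<Phi> :: "'k::field rep3 \<Rightarrow> 'k ^ 2 ^ 2"
  assumes "(\<lambda>\<rho>. trace (\<rho> (fgen i) ** \<rho> (fgen j))) \<in> (trace_polynomials :: ('k rep3 \<Rightarrow> 'k) set)"
    "\<Phi> \<in> trace_module" "(\<lambda>\<rho>. \<rho> (fgen i) ** \<Phi> \<rho>) \<in> trace_module"
    "(\<lambda>\<rho>. \<rho> (fgen j) ** \<Phi> \<rho>) \<in> trace_module"
    "(\<lambda>\<rho>. \<rho> (fgen i) ** (\<rho> (fgen j) ** \<Phi> \<rho>)) \<in> trace_module"
  shows "(\<lambda>\<rho>. \<rho> (fgen j) ** (\<rho> (fgen i) ** \<Phi> \<rho>)) \<in> trace_module"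
proof (rule trace_module.cong)
  show "(\<lambda>\<rho>. mat (- 1) ** (\<rho> (fgen i) ** (\<rho> (fgen j) ** \<Phi> \<rho>))
      + mat (trace (\<rho> (fgen i))) ** (\<rho> (fgen j) ** \<Phi> \<rho>)
      + mat (trace (\<rho> (fgen j))) ** (\<rho> (fgen i) ** \<Phi> \<rho>)
      + mat (trace (\<rho> (fgen i) ** \<rho> (fgen j)) - trace (\<rho> (fgen i)) * trace (\<rho> (fgen j))) ** \<Phi> \<rho>)
      \<in> trace_module"
    by (intro trace_module.add trace_module.scale assms trace_coordinates_in_trace_polynomials
        trace_polynomials_const trace_polynomials_diff trace_polynomials_mult)
  fix \<rho> :: "'k rep3"
  show "\<rho> (fgen j) ** (\<rho> (fgen i) ** \<Phi> \<rho>) =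
      mat (- 1) ** (\<rho> (fgen i) ** (\<rho> (fgen j) ** \<Phi> \<rho>))
      + mat (trace (\<rho> (fgen i))) ** (\<rho> (fgen j) ** \<Phi> \<rho>)
      + mat (trace (\<rho> (fgen j))) ** (\<rho> (fgen i) ** \<Phi> \<rho>)
      + mat (trace (\<rho> (fgen i) ** \<rho> (fgen j)) - trace (\<rho> (fgen i)) * trace (\<rho> (fgen j))) ** \<Phi> \<rho>"
    using arg_cong[OF mat2_swap[of "\<rho> (fgen j)" "\<rho> (fgen i)"], of "\<lambda>M. M ** \<Phi> \<rho>"]
    by (simp only: matrix_mul_assoc matrix_add_rdistrib)
qed

lemma trace_module_gen_square:
  "(\<lambda>\<rho>. \<rho> (fgen i) ** \<rho> (fgen i)) \<in> trace_module"
  using trace_module_square[OF trace_module.one, of i] exhaust_3[of i]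
  by (auto simp: trace_module.intros(1-8))

text \<open>A product without \<open>A\<close> becomes another of the eight; one starting with
  \<open>A\<close> is reduced by Cayley-Hamilton.\<close>

lemma trace_module_mult_1:
  "\<Phi> \<in> trace_module \<Longrightarrow> (\<lambda>\<rho>. \<rho> (fgen 1) ** \<Phi> \<rho>) \<in> trace_module"
proof (induction rule: trace_module.induct)
  case one
  show ?case by (simp only: matrix_mul_rid trace_module.a)
next
  case c
  show ?case by (rule trace_module.ac)
next
  case b
  show ?case by (rule trace_module.ab)
next
  case bc
  show ?case by (rule trace_module.abc)
next
  case a
  show ?case by (rule trace_module_gen_square)
next
  case ac
  show ?case by (rule trace_module_square[OF trace_module.c trace_module.ac])
next
  case ab
  show ?case by (rule trace_module_square[OF trace_module.b trace_module.ab])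
next
  case abc
  show ?case by (rule trace_module_square[OF trace_module.bc trace_module.abc])
next
  case (add \<Phi> \<Psi>)
  then show ?case by (simp only: matrix_add_ldistrib trace_module.add)
next
  case (scale f \<Phi>)
  then show ?case by (simp only: mat_scale_commute trace_module.scale)
next
  case (cong \<Phi> \<Psi>)
  show ?case by (rule trace_module.cong[OF cong.IH]) (simp add: cong.hyps)
qed

text \<open>Closure under \<open>A\<close> is already available, so moving \<open>B\<close> past
  \<open>A\<close> only asks that \<open>B\<close> times the remaining factor lies in the
  module.\<close>

lemma trace_module_swap_21:
  "\<Phi> \<in> trace_module \<Longrightarrow> (\<lambda>\<rho>. \<rho> (fgen 2) ** \<Phi> \<rho>) \<in> trace_module
    \<Longrightarrow> (\<lambda>\<rho>. \<rho> (fgen 2) ** (\<rho> (fgen 1) ** \<Phi> \<rho>)) \<in> trace_module"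
  by (intro trace_module_swap[of 1 2] trace_module_mult_1 trace_coordinates_in_trace_polynomials)

lemma trace_module_mult_2:
  "\<Phi> \<in> trace_module \<Longrightarrow> (\<lambda>\<rho>. \<rho> (fgen 2) ** \<Phi> \<rho>) \<in> trace_module"
proof (induction rule: trace_module.induct)
  case one
  show ?case by (simp only: matrix_mul_rid trace_module.b)
next
  case c
  show ?case by (rule trace_module.bc)
next
  case b
  show ?case by (rule trace_module_gen_square)
next
  case bc
  show ?case by (rule trace_module_square[OF trace_module.c trace_module.bc])
next
  case a
  show ?case using trace_module_swap_21[OF trace_module.one] by (simp add: trace_module.intros(1-8))
next
  case ac
  show ?case by (rule trace_module_swap_21[OF trace_module.c trace_module.bc])
next
  case ab
  show ?case by (rule trace_module_swap_21[OF trace_module.b trace_module_gen_square])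
next
  case abc
  show ?case by (rule trace_module_swap_21[OF trace_module.bc trace_module_square[OF trace_module.c trace_module.bc]])
next
  case (add \<Phi> \<Psi>)
  then show ?case by (simp only: matrix_add_ldistrib trace_module.add)
next
  case (scale f \<Phi>)
  then show ?case by (simp only: mat_scale_commute trace_module.scale)
next
  case (cong \<Phi> \<Psi>)
  show ?case by (rule trace_module.cong[OF cong.IH]) (simp add: cong.hyps)
qed

lemma trace_module_swap_31:
  "\<Phi> \<in> trace_module \<Longrightarrow> (\<lambda>\<rho>. \<rho> (fgen 3) ** \<Phi> \<rho>) \<in> trace_module
    \<Longrightarrow> (\<lambda>\<rho>. \<rho> (fgen 3) ** (\<rho> (fgen 1) ** \<Phi> \<rho>)) \<in> trace_module"
  by (intro trace_module_swap[of 1 3] trace_module_mult_1 trace_coordinates_in_trace_polynomials)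

lemma trace_module_swap_32:
  "\<Phi> \<in> trace_module \<Longrightarrow> (\<lambda>\<rho>. \<rho> (fgen 3) ** \<Phi> \<rho>) \<in> trace_module
    \<Longrightarrow> (\<lambda>\<rho>. \<rho> (fgen 3) ** (\<rho> (fgen 2) ** \<Phi> \<rho>)) \<in> trace_module"
  by (intro trace_module_swap[of 2 3] trace_module_mult_2 trace_coordinates_in_trace_polynomials)

lemma trace_module_cb: "(\<lambda>\<rho>. \<rho> (fgen 3) ** \<rho> (fgen 2)) \<in> trace_module"
  using trace_module_swap_32[OF trace_module.one] by (simp add: trace_module.intros(1-8))

text \<open>Here \<open>C\<close> is moved to the right past \<open>A\<close> and then
  \<open>B\<close>, until it meets \<open>C\<close> or the end of the product.\<close>

lemma trace_module_mult_3:
  "\<Phi> \<in> trace_module \<Longrightarrow> (\<lambda>\<rho>. \<rho> (fgen 3) ** \<Phi> \<rho>) \<in> trace_module"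
proof (induction rule: trace_module.induct)
  case one
  show ?case by (simp only: matrix_mul_rid trace_module.c)
next
  case c
  show ?case by (rule trace_module_gen_square)
next
  case b
  show ?case by (rule trace_module_cb)
next
  case bc
  show ?case by (rule trace_module_swap_32[OF trace_module.c trace_module_gen_square])
next
  case a
  show ?case using trace_module_swap_31[OF trace_module.one] by (simp add: trace_module.intros(1-8))
next
  case ac
  show ?case by (rule trace_module_swap_31[OF trace_module.c trace_module_gen_square])
next
  case ab
  show ?case by (rule trace_module_swap_31[OF trace_module.b trace_module_cb])
next
  case abc
  show ?case by (rule trace_module_swap_31[OF trace_module.bc trace_module_swap_32[OF trace_module.c trace_module_gen_square]])
next
  case (add \<Phi> \<Psi>)
  then show ?case by (simp only: matrix_add_ldistrib trace_module.add)
next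
  case (scale f \<Phi>)
  then show ?case by (simp only: mat_scale_commute trace_module.scale)
next
  case (cong \<Phi> \<Psi>)
  show ?case by (rule trace_module.cong[OF cong.IH]) (simp add: cong.hyps)
qed

lemma trace_module_mult:
  "\<Phi> \<in> trace_module \<Longrightarrow> (\<lambda>\<rho>. \<rho> (fgen i) ** \<Phi> \<rho>) \<in> trace_module"
  using exhaust_3[of i] trace_module_mult_1 trace_module_mult_2 trace_module_mult_3 by auto

lemma hom_inverse_letter:
  assumes "\<rho> \<in> (Rep3 :: 'k::field rep3 set)"
  shows "\<rho> (abs_fgroup [(i, False)]) = mat (trace (\<rho> (fgen i))) + mat (- 1) ** \<rho> (fgen i)"
proof (rule mat2_inverse)
  interpret F: group F3 by (rule group_free_group)
  interpret S: group "SL2 :: ('k ^ 2 ^ 2) monoid" by (rule group_SL2)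
  interpret h: group_hom F3 SL2 \<rho> by unfold_locales (rule assms)
  show "det (\<rho> (fgen i)) = 1" using assms by (auto simp: hom_def)
  have "fg_mult (abs_fgroup [(i, False)]) (fgen i) = fg_one"
    using free_eq.cancel[of "[]" i False "[]"]
    by (simp add: fgen.abs_eq fg_mult.abs_eq fg_one.abs_eq fgroup.abs_eq_iff)
  then show "\<rho> (abs_fgroup [(i, False)]) ** \<rho> (fgen i) = mat 1"
    using h.hom_mult[of "abs_fgroup [(i, False)]" "fgen i"] h.hom_one by simp
qed

text \<open>Words are built from the left: a generator preserves the module, and an inverse letter
  is a scalar minus a generator.\<close>

lemma word_in_trace_module: "(\<lambda>\<rho>. \<rho> (abs_fgroup s)) \<in> (trace_module :: ('k::field rep3 \<Rightarrow> _) set)"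
proof (induction s)
  interpret F: group F3 by (rule group_free_group)
  interpret S: group "SL2 :: ('k ^ 2 ^ 2) monoid" by (rule group_SL2)
  case Nil
  show ?case
  proof (rule trace_module.cong[OF trace_module.one])
    fix \<rho> :: "'k rep3" assume "\<rho> \<in> Rep3"
    then interpret h: group_hom F3 SL2 \<rho> by unfold_locales
    show "\<rho> (abs_fgroup []) = mat 1" using h.hom_one by (simp add: fg_one.abs_eq)
  qed
next
  case (Cons l s)
  obtain i b where l: "l = (i, b)" by (cases l)
  have hom: "\<rho> (abs_fgroup (l # s)) = \<rho> (abs_fgroup [l]) ** \<rho> (abs_fgroup s)"
    if "\<rho> \<in> Rep3" for \<rho> :: "'k rep3"
    using hom_mult[OF that, of "abs_fgroup [l]" "abs_fgroup s"] by (simp add: fg_mult.abs_eq)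
  show ?case
  proof (cases b)
    case True
    show ?thesis
      by (rule trace_module.cong[OF trace_module_mult[OF Cons.IH, of i]])
        (simp add: hom, simp add: l True fgen.abs_eq)
  next
    case False
    show ?thesis
    proof (rule trace_module.cong)
      show "(\<lambda>\<rho>. mat (trace (\<rho> (fgen i))) ** \<rho> (abs_fgroup s)
          + mat (- 1) ** (\<rho> (fgen i) ** \<rho> (abs_fgroup s))) \<in> (trace_module :: ('k rep3 \<Rightarrow> _) set)"
        by (intro trace_module.add trace_module.scale trace_module_mult Cons.IH
            trace_coordinates_in_trace_polynomials trace_polynomials_const)
    qed (simp add: hom, simp add: l False hom_inverse_letter matrix_add_rdistrib matrix_mul_assoc)
  qed
qed

section \<open>Characters as polynomials in the seven traces\<close>

lemma character_polynomial:
  obtains F where "F \<in> (poly_functions :: ('k::field ^ 7 \<Rightarrow> 'k) set)"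
    "\<And>\<rho>. \<rho> \<in> Rep3 \<Longrightarrow> trace (\<rho> g) = F (trace_coords (character \<rho>))"
proof -
  obtain s where "g = abs_fgroup s"
    by (metis Quotient_abs_rep Quotient_fgroup)
  then have "(\<lambda>\<rho>. trace (\<rho> g)) \<in> (trace_polynomials :: ('k rep3 \<Rightarrow> _) set)"
    using trace_trace_module[OF word_in_trace_module] by simp
  then show thesis using that unfolding trace_polynomials_def by blast
qed

lemma inj_on_trace_coords: "inj_on trace_coords (X3 :: (3 fgroup \<Rightarrow> 'k::field) set)"
proof (rule inj_onI)
  fix \<phi> \<psi> :: "3 fgroup \<Rightarrow> 'k"
  assume "\<phi> \<in> X3" "\<psi> \<in> X3" and eq: "trace_coords \<phi> = trace_coords \<psi>"
  then obtain \<rho> \<sigma> :: "'k rep3" where \<rho>: "\<rho> \<in> Rep3" "\<phi> = character \<rho>"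
    and \<sigma>: "\<sigma> \<in> Rep3" "\<psi> = character \<sigma>"
    by (auto simp: X3_def)
  show "\<phi> = \<psi>"
  proof
    fix g
    obtain F where "\<And>\<rho>. \<rho> \<in> Rep3 \<Longrightarrow> trace (\<rho> g) = (F (trace_coords (character \<rho>)) :: 'k)"
      using character_polynomial[of g] by metis
    then show "\<phi> g = \<psi> g"
      using \<rho> \<sigma> eq by (simp add: character_def[abs_def])
  qed
qed

text \<open>Hence every coordinate pulls back to one of the trace functions generating
  \<open>coordinate_ring_X3\<close>.\<close>

lemma trace_coords_nth:
  obtains g where "\<And>\<phi> :: 3 fgroup \<Rightarrow> 'k::field. trace_coords \<phi> $ i = \<phi> g"
proof -
  have "\<exists>g. \<forall>\<phi> :: 3 fgroup \<Rightarrow> 'k. trace_coords \<phi> $ i = \<phi> g"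
    using exhaust_7[of i]
    by (elim disjE)
      (simp only: trace_coords_def Let_def vector_7, rule exI, rule allI, rule HOL.refl)+
  then show thesis using that by blast
qed

lemma coordinate_ring_X3_eq:
  "(coordinate_ring_X3 :: ('k::field rep3 \<Rightarrow> 'k) set) =
    (\<lambda>F. \<lambda>\<rho>\<in>Rep3. F (trace_coords (character \<rho>))) ` poly_functions" (is "_ = ?E ` _")
proof (intro equalityI subsetI)
  fix f :: "'k rep3 \<Rightarrow> 'k"
  assume "f \<in> coordinate_ring_X3"
  then show "f \<in> ?E ` poly_functions"
    unfolding coordinate_ring_X3_def
  proof (induction rule: generated_subalgebra.induct)
    case (const c)
    show ?case by (rule image_eqI[OF _ poly_functions_const]) simp
  next
    case (gen f)
    then obtain g where f: "f = (\<lambda>\<rho>. trace (\<rho> g))" by auto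
    obtain F where "F \<in> poly_functions"
      "\<And>\<rho>. \<rho> \<in> Rep3 \<Longrightarrow> trace (\<rho> g) = (F (trace_coords (character \<rho>)) :: 'k)"
      using character_polynomial[of g] by metis
    then show ?case by (intro image_eqI[of _ _ F]) (auto simp: f restrict_def)
  next
    case (add f g)
    then obtain F G where FG: "F \<in> poly_functions" "G \<in> poly_functions" "f = ?E F" "g = ?E G"
      by blast
    show ?case
      by (rule image_eqI[OF _ poly_functions_add[OF FG(1,2)]]) (auto simp: FG(3,4) restrict_def)
  next
    case (mult f g)
    then obtain F G where FG: "F \<in> poly_functions" "G \<in> poly_functions" "f = ?E F" "g = ?E G"
      by blast
    show ?case
      by (rule image_eqI[OF _ poly_functions_mult[OF FG(1,2)]]) (auto simp: FG(3,4) restrict_def)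
  qed
next
  fix f :: "'k rep3 \<Rightarrow> 'k"
  assume "f \<in> ?E ` poly_functions"
  then obtain F where F: "F \<in> poly_functions" and f: "f = ?E F" by blast
  have "?E F \<in> coordinate_ring_X3"
    using F
  proof (induction rule: poly_functions_induct)
    case (const c)
    show ?case unfolding coordinate_ring_X3_def by (rule generated_subalgebra.const)
  next
    case (coord i)
    obtain g where g: "\<And>\<phi> :: 3 fgroup \<Rightarrow> 'k. trace_coords \<phi> $ i = \<phi> g"
      using trace_coords_nth by blast
    show ?case unfolding coordinate_ring_X3_def g character_def
      by (rule generated_subalgebra.gen) blast
  next
    case (add F G)
    have eq: "?E (\<lambda>p. F p + G p) = (\<lambda>\<rho>\<in>Rep3. ?E F \<rho> + ?E G \<rho>)"
      by (rule ext) simp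
    show ?case
      unfolding eq coordinate_ring_X3_def
      by (rule generated_subalgebra.add[OF add.IH[unfolded coordinate_ring_X3_def]])
  next
    case (mult F G)
    have eq: "?E (\<lambda>p. F p * G p) = (\<lambda>\<rho>\<in>Rep3. ?E F \<rho> * ?E G \<rho>)"
      by (rule ext) simp
    show ?case
      unfolding eq coordinate_ring_X3_def
      by (rule generated_subalgebra.mult[OF mult.IH[unfolded coordinate_ring_X3_def]])
  qed
  then show "f \<in> coordinate_ring_X3" using f by simp
qed

section \<open>Realising the points of the hypersurface\<close>

text \<open>The relation is made homogeneous of degree 2 in each matrix by inserting determinants,
  so it becomes a polynomial identity in the twelve entries. Keeping \<open>f\<close> free later
  allows \<open>det C\<close> to be computed from it.\<close>

lemma fricke_relation_entries:
  fixes a11 :: "'k::field"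
  assumes "x = a11 + a22" "y = b11 + b22" "z = c11 + c22"
    "u = b11 * c11 + b12 * c21 + (b21 * c12 + b22 * c22)"
    "v = a11 * c11 + a12 * c21 + (a21 * c12 + a22 * c22)"
    "w = a11 * b11 + a12 * b21 + (a21 * b12 + a22 * b22)"
    "P = (a11 * b11 + a12 * b21) * c11 + (a11 * b12 + a12 * b22) * c21
      + ((a21 * b11 + a22 * b21) * c12 + (a21 * b12 + a22 * b22) * c22)"
    "d = a11 * a22 - a12 * a21" "e = b11 * b22 - b12 * b21" "f = c11 * c22 - c12 * c21"
  shows "P\<^sup>2 = (w * z + v * y + u * x - x * y * z) * P - x\<^sup>2 * e * f - y\<^sup>2 * d * f - z\<^sup>2 * d * e
    + u * y * z * d + v * x * z * e + w * x * y * f - u * v * w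
    - u\<^sup>2 * d - v\<^sup>2 * e - w\<^sup>2 * f + 4 * d * e * f"
  using assms by algebra

lemma fricke_relation_det:
  fixes A B C :: "'k::field ^ 2 ^ 2"
  assumes "trace A = x" "trace B = y" "trace C = z"
    "trace (B ** C) = u" "trace (A ** C) = v" "trace (A ** B) = w" "trace (A ** B ** C) = P"
    "det A = d" "det B = e" "det C = f"
  shows "P\<^sup>2 = (w * z + v * y + u * x - x * y * z) * P - x\<^sup>2 * e * f - y\<^sup>2 * d * f - z\<^sup>2 * d * e
    + u * y * z * d + v * x * z * e + w * x * y * f - u * v * w
    - u\<^sup>2 * d - v\<^sup>2 * e - w\<^sup>2 * f + 4 * d * e * f"
  by (rule fricke_relation_entries[where ?a11.0 = "A $ 1 $ 1" and ?a12.0 = "A $ 1 $ 2"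
        and ?a21.0 = "A $ 2 $ 1" and ?a22.0 = "A $ 2 $ 2" and ?b11.0 = "B $ 1 $ 1"
        and ?b12.0 = "B $ 1 $ 2" and ?b21.0 = "B $ 2 $ 1" and ?b22.0 = "B $ 2 $ 2"
        and ?c11.0 = "C $ 1 $ 1" and ?c12.0 = "C $ 1 $ 2" and ?c21.0 = "C $ 2 $ 1"
        and ?c22.0 = "C $ 2 $ 2"])
    (simp_all only: assms[symmetric] det_2 trace_2 matrix_matrix_mult_def sum_2 vec_lambda_beta)

lemma trace_transpose: "trace (transpose A) = trace (A :: (_::semiring_1) ^ _ ^ _)"
  by (simp add: trace_def transpose_def)

text \<open>The left side is the trace of \<open>C ** B ** A\<close>, so this is the formula for the
  sum of the traces of \<open>ABC\<close> and \<open>CBA\<close>.\<close>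

lemma trace_reversed_product:
  fixes A B C :: "'k::field ^ 2 ^ 2"
  shows "trace (transpose A ** transpose B ** transpose C) =
    trace (A ** B) * trace C + trace (A ** C) * trace B + trace (B ** C) * trace A
    - trace A * trace B * trace C - trace (A ** B ** C)"
  by (simp add: trace_2 transpose_def matrix_matrix_mult_def sum_2) (simp add: algebra_simps)

lemma trace_transpose_mult:
  "trace (transpose A ** transpose B) = trace (A ** B)" for A B :: "'k::comm_semiring_1 ^ 'n ^ 'n"
  by (metis matrix_transpose_mul trace_transpose trace_mul_sym)

definition fricke_eq :: "'k::field \<Rightarrow> 'k \<Rightarrow> 'k \<Rightarrow> 'k \<Rightarrow> 'k \<Rightarrow> 'k \<Rightarrow> 'k \<Rightarrow> bool" where
  "fricke_eq x y z u v w P \<longleftrightarrow>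
    P\<^sup>2 = (w * z + v * y + u * x - x * y * z) * P - x\<^sup>2 - y\<^sup>2 - z\<^sup>2
      + u * y * z + v * x * z + w * x * y - u * v * w - u\<^sup>2 - v\<^sup>2 - w\<^sup>2 + 4"

definition has_traces ::
  "'k::field ^ 2 ^ 2 \<Rightarrow> 'k ^ 2 ^ 2 \<Rightarrow> 'k ^ 2 ^ 2 \<Rightarrow> 'k \<Rightarrow> 'k \<Rightarrow> 'k \<Rightarrow> 'k \<Rightarrow> 'k \<Rightarrow> 'k \<Rightarrow> 'k \<Rightarrow> bool" where
  "has_traces A B C x y z u v w P \<longleftrightarrow>
    det A = 1 \<and> det B = 1 \<and> det C = 1 \<and> trace A = x \<and> trace B = y \<and> trace C = z \<and>
    trace (B ** C) = u \<and> trace (A ** C) = v \<and> trace (A ** B) = w \<and> trace (A ** B ** C) = P"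

lemma has_traces_imp_fricke_eq: "has_traces A B C x y z u v w P \<Longrightarrow> fricke_eq x y z u v w P"
  unfolding has_traces_def fricke_eq_def
  using fricke_relation_det[of A x B y C z u v w P 1 1 1] by simp

text \<open>Transposing all three matrices keeps the first six traces and exchanges the two roots of
  the quadratic equation for the seventh.\<close>

lemma has_traces_both_roots:
  assumes "has_traces A B C x y z u v w Q" "fricke_eq x y z u v w P"
  shows "\<exists>A B C. has_traces A B C x y z u v w P"
proof (cases "P = Q")
  case True
  then show ?thesis using assms by blast
next
  case False
  \<comment> \<open>The quadratic has sum of roots \<open>S\<close> and product of roots
    \<open>- N\<close>, so a root other than \<open>Q\<close> is \<open>S - Q\<close>.\<close>
  define S N where "S = w * z + v * y + u * x - x * y * z"
    and "N = - x\<^sup>2 - y\<^sup>2 - z\<^sup>2 + u * y * z + v * x * z + w * x * y - u * v * w - u\<^sup>2 - v\<^sup>2 - w\<^sup>2 + 4"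
  have "Q\<^sup>2 = S * Q + N" "P\<^sup>2 = S * P + N"
    using has_traces_imp_fricke_eq[OF assms(1)] assms(2) by (simp_all add: fricke_eq_def S_def N_def)
  then have "(P - Q) * (P + Q - S) = 0"
    by (simp add: power2_eq_square algebra_simps)
  then have "P = S - Q"
    using False by (simp add: eq_diff_eq)
  then have "has_traces (transpose A) (transpose B) (transpose C) x y z u v w P"
    using assms(1) trace_reversed_product[of A B C]
    by (simp add: has_traces_def trace_transpose trace_transpose_mult det_transpose S_def N_def)
  then show ?thesis by blast
qed

section \<open>Construction of triples with prescribed traces\<close>

lemma quadratic_roots:
  obtains a b :: "'k::alg_closed_field" where "a + b = s" "a * b = n"
proof -
  obtain a where "poly [:n, - s, 1:] a = 0"
    using alg_closed_imp_poly_has_root[of "[:n, - s, 1:]"] by auto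
  then have "a * (s - a) = n" by (simp add: algebra_simps)
  then show thesis using that[of a "s - a"] by simp
qed

abbreviation mat2 :: "'k \<Rightarrow> 'k \<Rightarrow> 'k \<Rightarrow> 'k \<Rightarrow> 'k::zero ^ 2 ^ 2" where
  "mat2 p q r s \<equiv> vector [vector [p, q], vector [r, s]]"

lemmas mat2_simps = det_2 trace_2 matrix_matrix_mult_def sum_2 vector_2

text \<open>For \<open>A\<close>, \<open>B\<close> of determinant 1 with traces \<open>x\<close>,
  \<open>y\<close> and \<open>tr (AB) = w\<close>, this is the trace of their commutator minus
  2.\<close>

abbreviation kappa :: "'k::field \<Rightarrow> 'k \<Rightarrow> 'k \<Rightarrow> 'k" where
  "kappa x y w \<equiv> x\<^sup>2 + y\<^sup>2 + w\<^sup>2 - x * y * w - 4"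

text \<open>If the commutator of \<open>A\<close> and \<open>B\<close> does not have trace 2, then \<open>1, A, B, AB\<close> form a basis of the
  matrix algebra, so the four traces involving \<open>C\<close> determine \<open>C\<close>; the relation forces \<open>det C = 1\<close>.\<close>

lemma exists_triple_irreducible:
  fixes x :: "'k::alg_closed_field"
  assumes nz: "kappa x y w \<noteq> 0" and eq: "fricke_eq x y z u v w P"
  shows "\<exists>A B C. has_traces A B C x y z u v w P"
proof -
  \<comment> \<open>These will be the eigenvalues of \<open>A ** B\<close>, which is upper
    triangular with diagonal \<open>f\<close>, \<open>e\<close> for the matrices chosen
    below.\<close>
  obtain e f where ef: "e + f = w" "e * f = 1" by (rule quadratic_roots)
  define D where "D = kappa x y w"
  \<comment> \<open>The right side is the determinant of the linear system for the first column
    \<open>p\<close>, \<open>r\<close> of \<open>C\<close>; the two expressions agree because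
    \<open>e * f = 1\<close>.\<close>
  have D: "D = (f * x - y) * (x * e - y) + (e - f) * (e - f)"
  proof -
    have "D = (f * x - y) * (x * e - y) + (e - f) * (e - f) + (x\<^sup>2 - 4) * (1 - e * f)"
      unfolding D_def ef(1)[symmetric] by algebra
    then show ?thesis by (simp add: ef(2))
  qed
  have "D \<noteq> 0" using nz by (simp add: D_def)
  \<comment> \<open>The right-hand sides \<open>g\<close> and \<open>h\<close> encode
    \<open>tr (BC) = u\<close> and \<open>tr (ABC) = P\<close>; then \<open>p\<close> and
    \<open>r\<close> come from Cramer's rule.\<close>
  define g where "g = u + f * v - y * z"
  define h where "h = P - e * z"
  define p where "p = (g * (x * e - y) - h * (e - f)) / D"
  define r where "r = ((f * x - y) * h - (f - e) * g) / D"
  have p: "p * D = g * (x * e - y) - h * (e - f)" and r: "r * D = (f * x - y) * h - (f - e) * g"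
    using \<open>D \<noteq> 0\<close> by (simp_all add: p_def r_def)
  have "D * ((f * x - y) * p + (e - f) * r - g) = (f * x - y) * (p * D) + (e - f) * (r * D) - g * D"
    by algebra
  also have "\<dots> = 0" unfolding p r unfolding D by algebra
  finally have 1: "(f * x - y) * p + (e - f) * r = g" using \<open>D \<noteq> 0\<close> by simp
  have "D * ((f - e) * p + (x * e - y) * r - h) = (f - e) * (p * D) + (x * e - y) * (r * D) - h * D"
    by algebra
  also have "\<dots> = 0" unfolding p r unfolding D by algebra
  finally have 2: "(f - e) * p + (x * e - y) * r = h" using \<open>D \<noteq> 0\<close> by simp
  define A where "A = mat2 x (- 1) 1 0"
  define B where "B = mat2 0 e (- f) y"
  \<comment> \<open>The second column is dictated by \<open>tr C = z\<close> and
    \<open>tr (AC) = v\<close>.\<close>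
  define C where "C = mat2 p (v - x * p + r) r (z - p)"
  have det: "det A = 1" "det B = 1"
    using ef by (simp_all add: A_def B_def mat2_simps)
  have tr: "trace A = x" "trace B = y" "trace C = z" "trace (A ** C) = v" "trace (A ** B) = w"
    using ef by (simp_all add: A_def B_def C_def mat2_simps add.commute)
  have "trace (B ** C) = e * r + (y * (z - p) - f * (v - x * p + r))"
    by (simp add: B_def C_def mat2_simps)
  also have "\<dots> = ((f * x - y) * p + (e - f) * r) + y * z - f * v" by algebra
  also have "\<dots> = u" by (simp add: 1 g_def)
  finally have BC: "trace (B ** C) = u" .
  have "trace (A ** B ** C) = f * p + (x * e - y) * r + e * (z - p)"
    by (simp add: A_def B_def C_def mat2_simps)
  also have "\<dots> = ((f - e) * p + (x * e - y) * r) + e * z" by algebra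
  also have "\<dots> = P" by (simp add: 2 h_def)
  finally have ABC: "trace (A ** B ** C) = P" .
  \<comment> \<open>The assumed equation is the general relation with \<open>det C\<close> replaced
    by 1. The relation is affine in \<open>det C\<close> with coefficient \<open>- D\<close>, so
    subtracting leaves \<open>D * (det C - 1)\<close>.\<close>
  note arg_cong2[of _ _ _ _ minus, OF eq[unfolded fricke_eq_def]
      fricke_relation_det[OF tr(1,2,3) BC tr(4,5) ABC det HOL.refl]]
  also have "((w * z + v * y + u * x - x * y * z) * P - x\<^sup>2 - y\<^sup>2 - z\<^sup>2
        + u * y * z + v * x * z + w * x * y - u * v * w - u\<^sup>2 - v\<^sup>2 - w\<^sup>2 + 4)
      - ((w * z + v * y + u * x - x * y * z) * P - x\<^sup>2 * 1 * det C - y\<^sup>2 * 1 * det C - z\<^sup>2 * 1 * 1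
        + u * y * z * 1 + v * x * z * 1 + w * x * y * det C - u * v * w
        - u\<^sup>2 * 1 - v\<^sup>2 * 1 - w\<^sup>2 * det C + 4 * 1 * 1 * det C) = D * (det C - 1)"
    unfolding D_def by algebra
  finally have "D * (det C - 1) = 0" by simp
  then have "det C = 1" using \<open>D \<noteq> 0\<close> by simp
  then show ?thesis using det tr BC ABC unfolding has_traces_def by blast
qed

text \<open>As a quadratic in \<open>w\<close>, \<open>kappa\<close> has the roots
  \<open>a * b + a' * b'\<close> and \<open>a * b' + a' * b\<close>, the possible traces of a
  product of triangular matrices with these eigenvalues. Exchanging \<open>b\<close> and
  \<open>b'\<close> covers the second root.\<close>

lemma kappa_eq_0D:
  fixes x :: "'k::alg_closed_field"
  assumes "kappa x y w = 0" "a + a' = x" "a * a' = 1"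
  obtains b b' where "b + b' = y" "b * b' = 1" "a * b + a' * b' = w"
proof -
  obtain b b' where b: "b + b' = y" "b * b' = 1" by (rule quadratic_roots)
  have "(w - (a * b + a' * b')) * (w - (a * b' + a' * b)) = 0"
  proof -
    have "(w - (a * b + a' * b')) * (w - (a * b' + a' * b)) =
        w\<^sup>2 - w * (a + a') * (b + b') + (b * b') * ((a + a')\<^sup>2 - 2 * (a * a'))
        + (a * a') * ((b + b')\<^sup>2 - 2 * (b * b'))"
      by algebra
    also have "\<dots> = kappa x y w" unfolding assms(2,3) b by algebra
    finally show ?thesis using assms(1) by simp
  qed
  then have "a * b + a' * b' = w \<or> a * b' + a' * b = w" by auto
  then show thesis
    using that[of b b'] that[of b' b] b by (metis add.commute mult.commute)
qed

text \<open>If \<open>(A, B)\<close> and \<open>(A, C)\<close> are reducible, take \<open>A\<close> diagonal, \<open>B\<close> upper and \<open>C\<close> lower triangular.\<close>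

lemma exists_triple_reducible:
  fixes x :: "'k::alg_closed_field"
  assumes "kappa x y w = 0" "kappa x z v = 0" and eq: "fricke_eq x y z u v w P"
  shows "\<exists>A B C. has_traces A B C x y z u v w P"
proof -
  obtain a a' where a: "a + a' = x" "a * a' = 1" by (rule quadratic_roots)
  obtain b b' where b: "b + b' = y" "b * b' = 1" "a * b + a' * b' = w"
    using kappa_eq_0D[OF assms(1) a] .
  obtain c c' where c: "c + c' = z" "c * c' = 1" "a * c + a' * c' = v"
    using kappa_eq_0D[OF assms(2) a] .
  \<comment> \<open>The lower left entry of \<open>C\<close> is adjusted so that
    \<open>tr (BC) = u\<close>.\<close>
  define t where "t = u - b * c - b' * c'"
  define A where "A = mat2 a 0 0 a'"
  define B where "B = mat2 b 1 0 b'"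
  define C where "C = mat2 c 0 t c'"
  \<comment> \<open>The seventh trace is not prescribed here: it is one root of the quadratic, and
    transposition supplies the other if \<open>P\<close> differs from it.\<close>
  have "has_traces A B C x y z u v w (trace (A ** B ** C))"
    using a b c by (simp add: has_traces_def A_def B_def C_def mat2_simps t_def)
  then show ?thesis using has_traces_both_roots eq by blast
qed

lemma exists_triple:
  fixes x :: "'k::alg_closed_field"
  assumes "fricke_eq x y z u v w P"
  shows "\<exists>A B C. has_traces A B C x y z u v w P"
proof (cases "kappa x y w = 0")
  case False
  then show ?thesis using assms by (rule exists_triple_irreducible)
next
  case xyw: True
  show ?thesis
  proof (cases "kappa x z v = 0")
    case True
    with xyw show ?thesis using assms by (rule exists_triple_reducible)
  next
    case False
    \<comment> \<open>The irreducible case is applied to the cyclic rotation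
      \<open>(C, A, B)\<close>, which keeps the triple trace and permutes the other
      coordinates.\<close>
    then have "kappa z x v \<noteq> 0" by (simp add: algebra_simps)
    moreover have "fricke_eq z x y w u v P"
      using assms by (simp add: fricke_eq_def algebra_simps)
    ultimately obtain C A B where "has_traces C A B z x y w u v P"
      using exists_triple_irreducible by blast
    then have "has_traces A B C x y z u v w P"
      using trace_mul_sym[of C A] trace_mul_sym[of C B] trace_mul_sym[of C "A ** B"]
      by (simp add: has_traces_def matrix_mul_assoc)
    then show ?thesis by blast
  qed
qed

lemma trace_coords_image_X3:
  "trace_coords ` (X3 :: (3 fgroup \<Rightarrow> 'k::alg_closed_field) set) =
    {vector [x, y, z, u, v, w, P] | x y z u v w P. fricke_eq x y z u v w P}"
proof (intro equalityI subsetI)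
  fix p assume "p \<in> trace_coords ` (X3 :: (3 fgroup \<Rightarrow> 'k) set)"
  then obtain \<rho> :: "'k rep3" where \<rho>: "\<rho> \<in> Rep3" "p = trace_coords (character \<rho>)"
    by (auto simp: X3_def)
  define A B C where "A = \<rho> (fgen 1)" "B = \<rho> (fgen 2)" "C = \<rho> (fgen 3)"
  have "det A = 1" "det B = 1" "det C = 1"
    using \<rho>(1) by (auto simp: hom_def A_B_C_def)
  then have "has_traces A B C (trace A) (trace B) (trace C) (trace (B ** C)) (trace (A ** C))
      (trace (A ** B)) (trace (A ** B ** C))"
    by (simp add: has_traces_def)
  then show "p \<in> {vector [x, y, z, u, v, w, P] | x y z u v w P. fricke_eq x y z u v w P}"
    unfolding \<rho>(2) trace_coords_rep[OF \<rho>(1)] A_B_C_def[symmetric]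
    using has_traces_imp_fricke_eq by blast
next
  fix p :: "'k ^ 7"
  assume "p \<in> {vector [x, y, z, u, v, w, P] | x y z u v w P. fricke_eq x y z u v w P}"
  then obtain x y z u v w P where p: "p = vector [x, y, z, u, v, w, P]" "fricke_eq x y z u v w P"
    by blast
  obtain A B C where ABC: "has_traces A B C x y z u v w P"
    using exists_triple[OF p(2)] by blast
  then have "(A, B, C) \<in> triple ` Rep3"
    using bij_betw_triple unfolding bij_betw_def has_traces_def by auto
  then obtain \<rho> where \<rho>: "\<rho> \<in> Rep3" "triple \<rho> = (A, B, C)" by auto
  have "p = trace_coords (character \<rho>)"
    using ABC trace_coords_character[OF \<rho>] by (simp add: p(1) has_traces_def)
  then show "p \<in> trace_coords ` X3" using \<rho>(1) by (auto simp: X3_def)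
qed

section \<open>The vanishing ideal\<close>

text \<open>In a finite field, one plus the product of all \<open>X - a\<close> takes the value 1
  everywhere, yet it is not constant and so would have a root.\<close>

lemma infinite_UNIV_alg_closed: "infinite (UNIV :: 'k::alg_closed_field set)"
proof
  assume fin: "finite (UNIV :: 'k set)"
  define q :: "'k poly" where "q = (\<Prod>a\<in>UNIV. [:- a, 1:])"
  have root: "poly q a = 0" for a
    using fin by (simp add: q_def poly_prod)
  have "q \<noteq> 0" using fin by (simp add: q_def)
  have "degree (q + 1) > 0"
  proof (rule ccontr)
    assume "\<not> degree (q + 1) > 0"
    then obtain c where c: "q + 1 = [:c:]" by (auto elim: degree_eq_zeroE)
    have "c = poly (q + 1) 0" by (simp only: c) simp
    also have "\<dots> = 1" by (simp add: root)
    finally show False using c \<open>q \<noteq> 0\<close> by (simp add: one_pCons)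
  qed
  then show False
    using alg_closed_imp_poly_has_root[of "q + 1"] by (auto simp: root)
qed

lemma poly_functions_on_line:
  fixes f :: "'k::field ^ 'n \<Rightarrow> 'k"
  assumes "f \<in> poly_functions"
  shows "\<exists>Q. \<forall>t. f (\<chi> i. p $ i + t * (q $ i - p $ i)) = poly Q t"
  using assms
proof (induction rule: poly_functions_induct)
  case (const c)
  show ?case by (rule exI[of _ "[:c:]"]) simp
next
  case (coord i)
  show ?case by (rule exI[of _ "[:p $ i, q $ i - p $ i:]"]) simp
next
  case (add f g)
  then show ?case by (metis poly_add)
next
  case (mult f g)
  then show ?case by (metis poly_mult)
qed

text \<open>A polynomial function vanishing on the nonempty open set \<open>d \<noteq> 0\<close> is zero: on the line from a
  given point to a point of this set it has infinitely many zeros.\<close>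

lemma poly_functions_vanishing_on_open:
  fixes g d :: "'k::alg_closed_field ^ 'n \<Rightarrow> 'k"
  assumes g: "g \<in> poly_functions" and d: "d \<in> poly_functions"
    and van: "\<And>p. d p \<noteq> 0 \<Longrightarrow> g p = 0" and q: "d q \<noteq> 0"
  shows "g p = 0"
proof -
  define line where "line t = (\<chi> i. p $ i + t * (q $ i - p $ i))" for t
  obtain G where G: "\<And>t. g (line t) = poly G t"
    using poly_functions_on_line[OF g, of p q] by (auto simp: line_def)
  obtain H where H: "\<And>t. d (line t) = poly H t"
    using poly_functions_on_line[OF d, of p q] by (auto simp: line_def)
  have line: "line 0 = p" "line 1 = q" by (simp_all add: line_def vec_eq_iff)
  have "H \<noteq> 0" using H[of 1] q by (auto simp: line)
  \<comment> \<open>At each \<open>t\<close> either \<open>H\<close> vanishes or the hypothesis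
    makes \<open>G\<close> vanish; over an infinite field the product is then the zero
    polynomial.\<close>
  moreover have "poly (G * H) t = 0" for t
    using van[of "line t"] by (auto simp: G H)
  ultimately have "G = 0"
    using infinite_UNIV_alg_closed[where 'k = 'k] poly_roots_finite[of "G * H"] by auto
  then show ?thesis using G[of 0] by (simp add: line)
qed

section \<open>Division by the defining equation\<close>

definition free_of_P :: "('k::field ^ 7 \<Rightarrow> 'k) set" where
  "free_of_P = {f \<in> poly_functions. \<forall>p q. (\<forall>i. i \<noteq> 7 \<longrightarrow> p $ i = q $ i) \<longrightarrow> f p = f q}"

lemma free_of_P_intros:
  "(\<lambda>p. c) \<in> free_of_P"
  "i \<noteq> 7 \<Longrightarrow> (\<lambda>p. p $ i) \<in> free_of_P"
  "f \<in> free_of_P \<Longrightarrow> g \<in> free_of_P \<Longrightarrow> (\<lambda>p. f p + g p) \<in> free_of_P"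
  "f \<in> free_of_P \<Longrightarrow> g \<in> free_of_P \<Longrightarrow> (\<lambda>p. f p * g p) \<in> free_of_P"
  "f \<in> free_of_P \<Longrightarrow> g \<in> free_of_P \<Longrightarrow> (\<lambda>p. f p - g p) \<in> free_of_P"
  "f \<in> free_of_P \<Longrightarrow> (\<lambda>p. f p ^ n) \<in> free_of_P"
  unfolding free_of_P_def mem_Collect_eq
  by (intro conjI poly_functions_intros poly_functions_diff poly_functions_power; metis)+

lemma free_of_P_subset: "f \<in> free_of_P \<Longrightarrow> f \<in> poly_functions"
  by (simp add: free_of_P_def)

definition fricke_sum :: "'k::field ^ 7 \<Rightarrow> 'k" where
  "fricke_sum p = p $ 6 * p $ 3 + p $ 5 * p $ 2 + p $ 4 * p $ 1 - p $ 1 * p $ 2 * p $ 3"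

text \<open>Minus the product of the two roots in the seventh coordinate.\<close>

definition fricke_const :: "'k::field ^ 7 \<Rightarrow> 'k" where
  "fricke_const p =
    p $ 4 * p $ 2 * p $ 3 + p $ 5 * p $ 1 * p $ 3 + p $ 6 * p $ 1 * p $ 2 - p $ 4 * p $ 5 * p $ 6
    - (p $ 1)\<^sup>2 - (p $ 2)\<^sup>2 - (p $ 3)\<^sup>2 - (p $ 4)\<^sup>2 - (p $ 5)\<^sup>2 - (p $ 6)\<^sup>2 + 4"

lemma fricke_quadratic: "fricke p = (p $ 7)\<^sup>2 - (fricke_sum p * p $ 7 + fricke_const p)"
  by (simp add: fricke_def fricke_sum_def fricke_const_def Let_def)

lemma fricke_coeffs_free_of_P: "fricke_sum \<in> free_of_P" "fricke_const \<in> free_of_P"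
  unfolding fricke_sum_def[abs_def] fricke_const_def[abs_def]
  by (intro free_of_P_intros; simp)+

lemma fricke_poly_function: "fricke \<in> poly_functions"
  unfolding fricke_quadratic[abs_def]
  by (intro poly_functions_intros poly_functions_diff poly_functions_power
      fricke_coeffs_free_of_P[THEN free_of_P_subset])

text \<open>Division by a monic quadratic, proved along the generation of polynomial functions; only
  products create a square of the seventh coordinate.\<close>

lemma fricke_division:
  fixes f :: "'k::field ^ 7 \<Rightarrow> 'k"
  assumes "f \<in> poly_functions"
  shows "\<exists>q\<in>poly_functions. \<exists>r\<in>free_of_P. \<exists>s\<in>free_of_P.
    \<forall>p. f p = fricke p * q p + (r p * p $ 7 + s p)"
  using assms
proof (induction rule: poly_functions_induct)
  case (const c)
  show ?case
    by (rule bexI[of _ "\<lambda>p. 0"], rule bexI[of _ "\<lambda>p. 0"], rule bexI[of _ "\<lambda>p. c"])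
      (simp_all add: free_of_P_intros poly_functions_const)
next
  case (coord i)
  show ?case
  proof (cases "i = 7")
    case True
    then show ?thesis
      by (intro bexI[of _ "\<lambda>p. 0"] bexI[of _ "\<lambda>p. 1"])
        (simp_all add: free_of_P_intros poly_functions_const)
  next
    case False
    then show ?thesis
      by (intro bexI[of _ "\<lambda>p. 0"] bexI[of _ "\<lambda>p. p $ i"])
        (simp_all add: free_of_P_intros poly_functions_const)
  qed
next
  case (add f g)
  from add.IH obtain q r s q' r' s' where
    qrs: "q \<in> poly_functions" "r \<in> free_of_P" "s \<in> free_of_P"
      "q' \<in> poly_functions" "r' \<in> free_of_P" "s' \<in> free_of_P"
    and f: "\<And>p. f p = fricke p * q p + (r p * p $ 7 + s p)"
    and g: "\<And>p. g p = fricke p * q' p + (r' p * p $ 7 + s' p)"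
    by blast
  show ?case
  proof (intro bexI allI)
    show "f p + g p = fricke p * (q p + q' p) + ((r p + r' p) * p $ 7 + (s p + s' p))" for p
      by (simp add: f g algebra_simps)
  qed (intro qrs poly_functions_add free_of_P_intros)+
next
  case (mult f g)
  from mult.IH obtain q r s q' r' s' where
    qrs: "q \<in> poly_functions" "r \<in> free_of_P" "s \<in> free_of_P"
      "q' \<in> poly_functions" "r' \<in> free_of_P" "s' \<in> free_of_P"
    and f: "\<And>p. f p = fricke p * q p + (r p * p $ 7 + s p)"
    and g: "\<And>p. g p = fricke p * q' p + (r' p * p $ 7 + s' p)"
    by blast
  show ?case
  proof (intro bexI allI)
    \<comment> \<open>The term \<open>r p * r' p\<close> times the square of \<open>p $ 7\<close> is
      replaced using \<open>fricke_quadratic\<close>, which contributes to quotient and remainder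
      alike.\<close>
    show "f p * g p = fricke p * (q p * g p + (r p * p $ 7 + s p) * q' p + r p * r' p)
        + ((r p * r' p * fricke_sum p + r p * s' p + s p * r' p) * p $ 7
          + (s p * s' p + r p * r' p * fricke_const p))" for p
      unfolding f g fricke_quadratic by algebra
  qed (intro qrs mult.hyps poly_functions_add poly_functions_mult poly_functions_coord
      free_of_P_intros free_of_P_subset fricke_coeffs_free_of_P)+
qed

lemma fricke_discriminant_nonzero:
  obtains p :: "'k::alg_closed_field ^ 7" where "(fricke_sum p)\<^sup>2 + 4 * fricke_const p \<noteq> 0"
proof -
  obtain t :: 'k where t: "t \<noteq> 2" "t \<noteq> - 2"
    using ex_new_if_finite[OF infinite_UNIV_alg_closed, of "{2, - 2}"] by auto
  \<comment> \<open>With \<open>x = u = t\<close> and the rest 0, the sum is the square of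
    \<open>t\<close> and the discriminant is a perfect square, nonzero also in characteristic
    2.\<close>
  have "(fricke_sum (vector [t, 0, 0, t, 0, 0, 0]))\<^sup>2 + 4 * fricke_const (vector [t, 0, 0, t, 0, 0, 0])
      = ((t - 2) * (t + 2))\<^sup>2"
    by (simp add: fricke_sum_def fricke_const_def vector_7) algebra
  also have "\<dots> \<noteq> 0" using t by (simp add: add_eq_0_iff2)
  finally show thesis by (rule that)
qed

text \<open>Over a point where the discriminant of the quadratic in \<open>P\<close> is nonzero, the remainder of \<open>f\<close>, which is
  linear in \<open>P\<close>, has two distinct roots.\<close>

lemma vanishing_on_fricke:
  fixes f :: "'k::alg_closed_field ^ 7 \<Rightarrow> 'k"
  assumes f: "f \<in> poly_functions" and van: "\<And>p. fricke p = 0 \<Longrightarrow> f p = 0"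
  shows "f \<in> principal_ideal fricke"
proof -
  from fricke_division[OF f] obtain q r s where
    qrs: "q \<in> poly_functions" "r \<in> free_of_P" "s \<in> free_of_P"
    and eq: "\<And>p. f p = fricke p * q p + (r p * p $ 7 + s p)"
    by blast
  define d where "d p = (fricke_sum p)\<^sup>2 + 4 * fricke_const p" for p :: "'k ^ 7"
  have d: "d \<in> poly_functions"
    unfolding d_def[abs_def]
    by (intro poly_functions_intros poly_functions_power
        fricke_coeffs_free_of_P[THEN free_of_P_subset])
  have rs: "r p = 0 \<and> s p = 0" if dp: "d p \<noteq> 0" for p
  proof -
    obtain a b where ab: "a + b = fricke_sum p" "a * b = - fricke_const p"
      by (rule quadratic_roots)
    have "(a - b)\<^sup>2 = (a + b)\<^sup>2 - 4 * (a * b)" by algebra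
    also have "\<dots> = d p" by (simp add: ab d_def)
    finally have "a \<noteq> b" using dp by auto
    have root: "r p * c + s p = 0" if c: "c\<^sup>2 = fricke_sum p * c + fricke_const p" for c
    proof -
      \<comment> \<open>Moving the seventh coordinate of \<open>p\<close> to a root \<open>c\<close>
        gives a point of the hypersurface without changing \<open>r\<close> and
        \<open>s\<close>.\<close>
      define p' where "p' = (\<chi> i. if i = 7 then c else p $ i)"
      have same: "h p' = h p" if "h \<in> free_of_P" for h
        using that by (auto simp: free_of_P_def p'_def)
      have "p' $ 7 = c" by (simp add: p'_def)
      moreover from this have "fricke p' = 0"
        using c by (simp add: fricke_quadratic same fricke_coeffs_free_of_P)
      ultimately show ?thesis
        using van[of p'] eq[of p'] by (simp add: same qrs)
    qed
    have "fricke_const p = - (a * b)" using ab by simp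
    then have zero: "r p * a + s p = 0" "r p * b + s p = 0"
      by (intro root; simp add: flip: ab(1); simp add: power2_eq_square algebra_simps)+
    have "r p * (a - b) = (r p * a + s p) - (r p * b + s p)" by algebra
    then have "r p * (a - b) = 0" by (simp add: zero)
    then show ?thesis using \<open>a \<noteq> b\<close> zero by auto
  qed
  obtain p0 where "d p0 \<noteq> 0"
    using fricke_discriminant_nonzero unfolding d_def by blast
  \<comment> \<open>The remainder coefficients vanish where \<open>d\<close> is nonzero, hence
    everywhere.\<close>
  then have "r p = 0" "s p = 0" for p
    using poly_functions_vanishing_on_open[OF _ d] qrs(2,3) rs free_of_P_subset by blast+
  then have "f = (\<lambda>p. fricke p * q p)" by (simp add: eq fun_eq_iff)
  then show ?thesis using qrs(1) unfolding principal_ideal_def by blast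
qed

lemma fricke_vector_eq_0_iff: "fricke (vector [x, y, z, u, v, w, P]) = 0 \<longleftrightarrow> fricke_eq x y z u v w P"
  by (simp add: fricke_def fricke_eq_def vector_7 Let_def)

lemma fricke_hypersurface:
  "{vector [x, y, z, u, v, w, P] | x y z u v w P. fricke_eq x y z u v w P} =
    {p :: 'k::field ^ 7. fricke p = 0}"
proof (intro equalityI subsetI)
  fix p :: "'k ^ 7"
  assume p: "p \<in> {p. fricke p = 0}"
  have eq: "vector [p $ 1, p $ 2, p $ 3, p $ 4, p $ 5, p $ 6, p $ 7] = p"
    unfolding vec_eq_iff
  proof
    fix i show "vector [p $ 1, p $ 2, p $ 3, p $ 4, p $ 5, p $ 6, p $ 7] $ i = p $ i"
      using exhaust_7[of i] by (elim disjE) (simp_all only: vector_7)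
  qed
  have "fricke_eq (p $ 1) (p $ 2) (p $ 3) (p $ 4) (p $ 5) (p $ 6) (p $ 7)"
    using p by (simp add: eq flip: fricke_vector_eq_0_iff)
  then show "p \<in> {vector [x, y, z, u, v, w, P] | x y z u v w P. fricke_eq x y z u v w P}"
    using eq[symmetric] by blast
qed (auto simp: fricke_vector_eq_0_iff)

lemma vanishing_ideal_fricke:
  "vanishing_ideal {p. fricke p = 0} = principal_ideal (fricke :: 'k::alg_closed_field ^ 7 \<Rightarrow> 'k)"
proof (intro equalityI subsetI)
  fix f :: "'k ^ 7 \<Rightarrow> 'k"
  assume "f \<in> principal_ideal fricke"
  then show "f \<in> vanishing_ideal {p. fricke p = 0}"
    by (auto simp: principal_ideal_def vanishing_ideal_def
        intro!: poly_functions_mult fricke_poly_function)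
qed (auto simp: vanishing_ideal_def intro: vanishing_on_fricke)

text \<open>Injectivity together with the coordinate ring makes the seven traces an embedding of
  affine varieties. The last conjunct shows that the equation generates the full ideal, not merely
  an ideal with the right zero set.\<close>

theorem theorem1p2:
  shows "inj_on trace_coords (X3 :: (3 fgroup \<Rightarrow> 'k::alg_closed_field) set) \<and>
    (coordinate_ring_X3 :: ('k rep3 \<Rightarrow> 'k) set) =
      (\<lambda>F. \<lambda>\<rho>\<in>Rep3. F (trace_coords (character \<rho>))) ` poly_functions \<and>
    trace_coords ` (X3 :: (3 fgroup \<Rightarrow> 'k) set) =
      {vector [x, y, z, u, v, w, P] | x y z u v w P.
        P\<^sup>2 = (w * z + v * y + u * x - x * y * z) * P - x\<^sup>2 - y\<^sup>2 - z\<^sup>2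
          + u * y * z + v * x * z + w * x * y - u * v * w - u\<^sup>2 - v\<^sup>2 - w\<^sup>2 + 4} \<and>
    vanishing_ideal (trace_coords ` (X3 :: (3 fgroup \<Rightarrow> 'k) set)) = principal_ideal fricke"
proof (intro conjI)
  show "inj_on trace_coords (X3 :: (3 fgroup \<Rightarrow> 'k) set)"
    by (rule inj_on_trace_coords)
  show "(coordinate_ring_X3 :: ('k rep3 \<Rightarrow> 'k) set) =
      (\<lambda>F. \<lambda>\<rho>\<in>Rep3. F (trace_coords (character \<rho>))) ` poly_functions"
    by (rule coordinate_ring_X3_eq)
  show "trace_coords ` (X3 :: (3 fgroup \<Rightarrow> 'k) set) =
      {vector [x, y, z, u, v, w, P] | x y z u v w P.
        P\<^sup>2 = (w * z + v * y + u * x - x * y * z) * P - x\<^sup>2 - y\<^sup>2 - z\<^sup>2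
          + u * y * z + v * x * z + w * x * y - u * v * w - u\<^sup>2 - v\<^sup>2 - w\<^sup>2 + 4}"
    using trace_coords_image_X3[where 'k = 'k] unfolding fricke_eq_def .
  show "vanishing_ideal (trace_coords ` (X3 :: (3 fgroup \<Rightarrow> 'k) set)) = principal_ideal fricke"
    unfolding trace_coords_image_X3 fricke_hypersurface by (rule vanishing_ideal_fricke)
qed

end
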